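(* Let $D$ be a finite set, let $\Gamma$ be a valued constraint language over $D$ with $|\Gamma|$ finite, and let $\Gamma_e=\{\mathbb{D}_\Gamma,\mu_\Gamma\}$ be the extended dual of $\Gamma$. If $\Gamma$ is a rigid core, then for any fractional polymorphism $\omega$ of $\Gamma$ there is a corresponding fractional polymorphism $\omega_e$ of $\Gamma_e$ (of the same arity) such that for each $f\in\mathrm{supp}(\omega)$ there is a corresponding $f_e\in\mathrm{supp}(\omega_e)$ and vice versa, and $\omega_e(f_e)=\omega(f)$ for all $f_e\in\mathrm{supp}(\omega_e)$.
   Context: Let $\overline{\mathbb{Q}}=\mathbb{Q}\cup\{\infty\}$. An $m$-ary cost function over a finite set $A$ is a map $\phi:A^m\to\overline{\mathbb{Q}}$, with $\mathrm{Feas}(\phi)=\{\mathbf{x}:\phi(\mathbf{x})<\infty\}$; $\mathbf{x}[i]$ is the $i$th component. A binary relation ($\{0,\infty\}$-valued cost function) is identified with a digraph. An operation $f:A^k\to A$ is a polymorphism of $\phi$ if it maps $k$-tuples of members of $\mathrm{Feas}(\phi)$ (applied componentwise) into $\mathrm{Feas}(\phi)$; $\mathrm{Pol}^{(k)}(\Gamma)$ is the set of $k$-ary common polymorphisms of all members of $\Gamma$. A $k$-ary fractional polymorphism of $\Gamma$ is a probability distribution $\omega:\mathrm{Pol}^{(k)}(\Gamma)\to\mathbb{Q}_{\ge0}$ with $\sum_f\omega(f)\phi(f(\mathbf{x}_1,\dots,\mathbf{x}_k))\le\frac1k\sum_i\phi(\mathbf{x}_i)$ for all $\phi\in\Gamma$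 and $\mathbf{x}_1,\dots,\mathbf{x}_k\in\mathrm{Feas}(\phi)$; $\mathrm{supp}(\omega)=\{f:\omega(f)>0\}$; $\mathrm{supp}(\Gamma)$ is the union of $\mathrm{supp}(\omega)$ over all fractional polymorphisms $\omega$ of $\Gamma$; $\Gamma$ is a rigid core if the only unary operation in $\mathrm{supp}(\Gamma)$ is the identity. Combined cost function: for $\Gamma=\{\phi_1,\dots,\phi_q\}$ (none identically $\infty$) with arities $m_1,\dots,m_q$ and $m=\sum m_i$, $\phi_\Gamma(x_1,\dots,x_m)=\phi_1(x_1,\dots,x_{m_1})+\dots+\phi_q(x_{m-m_q+1},\dots,x_m)$; $D'=\mathrm{Feas}(\phi_\Gamma)\subseteq D^m$. Extended dual: a zigzag is the oriented path $\bullet\to\bullet\leftarrow\bullet\to\bullet$. For $S\subseteq\{1,\dots,m\}$ let $\mathbb{Q}_{S,i}$ be a single edge if $i\in S$ and a zigzag otherwise, and let $\mathbb{Q}_S$ be the concatenation (last vertex identified with next first vertex) of a single edge, $\mathbb{Q}_{S,1},\dots,\mathbb{Q}_{S,m}$, and a single edge. $\mathbb{D}_\Gamma$ is obtained from the digraph on $D\cup D'$ (disjoint union) with edges $D\times D'$ by replacing each edge $(d,\mathbf{x})$ with a copy of $\mathbb{Q}_{\{i:\mathbf{x}[i]=d\}}$ from $d$ to $\mathbf{x}$ with new internal vertices; its vertex set is $V=D\cup D'\cup E$ with $E$ the internal vertices. $\mu_\Gamma(v)=\phi_\Gamma(v)$ for $v\in D'$, $0$ otherwise. $\Gamma_e=\{\mathbb{D}_\Gamma,\mu_\Gamma\}$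 is a language over domain $V$. For $f\in\mathrm{Pol}^{(k)}(\Gamma)$, a corresponding $f_e\in\mathrm{Pol}^{(k)}(\Gamma_e)$ means one with $f_e(\mathbf{x}_1,\dots,\mathbf{x}_k)=f(\mathbf{x}_1,\dots,\mathbf{x}_k)$ (componentwise) when all $\mathbf{x}_i\in D'$ and $f_e(\mathbf{x}_1,\dots,\mathbf{x}_k)\notin D'$ otherwise.
   Formalization: Added assumption: the combined cost function φ_Γ is nonnegative on D'. Without it the claim fails, e.g. D={a}, φ(a)=−1, ω the unique binary operation: f_e((a),a) lies outside D' and costs 0 > −1/2. *)

theory Defs
  imports Complex_Main "HOL-Library.FuncSet"
begin

section \<open>Costs and cost functions\<close>

text \<open>The rationals extended by a single positive infinity.\<close>

datatype qbar = Fin (fin_part: rat) | Infty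

instantiation qbar :: comm_monoid_add
begin

definition zero_qbar :: qbar where
  "0 = Fin 0"

fun plus_qbar :: "qbar \<Rightarrow> qbar \<Rightarrow> qbar" where
  "Fin a + Fin b = Fin (a + b)"
| "Infty + _ = Infty"
| "_ + Infty = Infty"

instance
proof
  fix a b c :: qbar
  show "a + b + c = a + (b + c)"
    by (cases a; cases b; cases c) simp_all
  show "a + b = b + a"
    by (cases a; cases b) simp_all
  show "0 + a = a"
    by (cases a) (simp_all add: zero_qbar_def)
qed

end

definition tuples :: "'a set \<Rightarrow> nat \<Rightarrow> 'a list set" where
  "tuples A n = {xs. length xs = n \<and> set xs \<subseteq> A}"

text \<open>A cost function is stored together with its arity. To be a map on \<open>A\<^sup>m\<close> and nothing more,
  it is extensional, i.e. \<open>undefined\<close> off \<^term>\<open>tuples A m\<close>.\<close>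

type_synonym 'a cost_fun = "nat \<times> ('a list \<Rightarrow> qbar)"

definition cost_function :: "'a set \<Rightarrow> 'a cost_fun \<Rightarrow> bool" where
  "cost_function A c \<longleftrightarrow> snd c \<in> extensional (tuples A (fst c))"

definition valued_language :: "'a set \<Rightarrow> 'a cost_fun set \<Rightarrow> bool" where
  "valued_language A \<Gamma> \<longleftrightarrow> (\<forall>c\<in>\<Gamma>. cost_function A c)"

definition feas :: "'a set \<Rightarrow> 'a cost_fun \<Rightarrow> 'a list set" where
  "feas A c = {x \<in> tuples A (fst c). snd c x \<noteq> Infty}"

definition digraph_cost :: "'a set \<Rightarrow> ('a \<times> 'a) set \<Rightarrow> 'a cost_fun" where
  "digraph_cost A E =
     (2, restrict (\<lambda>x. if (x ! 0, x ! 1) \<in> E then Fin 0 else Infty) (tuples A 2))"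


section \<open>Polymorphisms and fractional polymorphisms\<close>

definition operations :: "'a set \<Rightarrow> nat \<Rightarrow> ('a list \<Rightarrow> 'a) set" where
  "operations A k = tuples A k \<rightarrow>\<^sub>E A"

text \<open>Componentwise application of an operation to a list of \<open>m\<close>-tuples.\<close>

definition app_cw :: "nat \<Rightarrow> ('a list \<Rightarrow> 'a) \<Rightarrow> 'a list list \<Rightarrow> 'a list" where
  "app_cw m f xs = map (\<lambda>i. f (map (\<lambda>x. x ! i) xs)) [0..<m]"

definition Pol :: "'a set \<Rightarrow> nat \<Rightarrow> 'a cost_fun set \<Rightarrow> ('a list \<Rightarrow> 'a) set" where
  "Pol A k \<Gamma> = {f \<in> operations A k.
     \<forall>c\<in>\<Gamma>. \<forall>xs \<in> tuples (feas A c) k. app_cw (fst c) f xs \<in> feas A c}"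

text \<open>A distribution on \<^term>\<open>Pol A k \<Gamma>\<close> is represented as a function on all operations that
  vanishes outside \<^term>\<open>Pol A k \<Gamma>\<close>. All costs occurring in the inequality are finite, since
  polymorphisms preserve feasibility.\<close>

definition fractional_polymorphism ::
    "'a set \<Rightarrow> nat \<Rightarrow> 'a cost_fun set \<Rightarrow> (('a list \<Rightarrow> 'a) \<Rightarrow> rat) \<Rightarrow> bool" where
  "fractional_polymorphism A k \<Gamma> \<omega> \<longleftrightarrow>
     0 < k \<and>
     (\<forall>f. 0 \<le> \<omega> f) \<and> (\<forall>f. f \<notin> Pol A k \<Gamma> \<longrightarrow> \<omega> f = 0) \<and>
     (\<Sum>f\<in>Pol A k \<Gamma>. \<omega> f) = 1 \<and>
     (\<forall>c\<in>\<Gamma>. \<forall>xs \<in> tuples (feas A c) k.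
        (\<Sum>f\<in>Pol A k \<Gamma>. \<omega> f * fin_part (snd c (app_cw (fst c) f xs)))
          \<le> (1 / of_nat k) * (\<Sum>x\<leftarrow>xs. fin_part (snd c x)))"

definition supp :: "(('a list \<Rightarrow> 'a) \<Rightarrow> rat) \<Rightarrow> ('a list \<Rightarrow> 'a) set" where
  "supp \<omega> = {f. \<omega> f > 0}"

text \<open>The members of the support of a language are tagged with their arity: one and the same
  HOL function may be an element of \<^term>\<open>operations A k\<close> for several \<open>k\<close>
  (namely when \<^term>\<open>undefined \<in> A\<close>).\<close>

definition supp_lang :: "'a set \<Rightarrow> 'a cost_fun set \<Rightarrow> (nat \<times> ('a list \<Rightarrow> 'a)) set" where
  "supp_lang A \<Gamma> = {(k, f). \<exists>\<omega>. fractional_polymorphism A k \<Gamma> \<omega> \<and> f \<in> supp \<omega>}"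

definition rigid_core :: "'a set \<Rightarrow> 'a cost_fun set \<Rightarrow> bool" where
  "rigid_core A \<Gamma> \<longleftrightarrow> {f. (1, f) \<in> supp_lang A \<Gamma>} = {restrict hd (tuples A 1)}"


section \<open>The extended dual\<close>

text \<open>The combined cost function depends on the order in which the language is enumerated, so it is
  defined on lists of cost functions.\<close>

fun combined_val :: "'a cost_fun list \<Rightarrow> 'a list \<Rightarrow> qbar" where
  "combined_val [] x = 0"
| "combined_val (c # cs) x = snd c (take (fst c) x) + combined_val cs (drop (fst c) x)"

definition combined :: "'a set \<Rightarrow> 'a cost_fun list \<Rightarrow> 'a cost_fun" where
  "combined D cs =
     (let m = sum_list (map fst cs) in (m, restrict (combined_val cs) (tuples D m)))"

text \<open>An oriented path is given by the list of its edge directions: entry \<open>p\<close> is \<^term>\<open>True\<close> if the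
  edge between the vertices at positions \<open>p\<close> and \<open>p + 1\<close> points forward. Concatenation of
  paths is then concatenation of lists. Coordinates are counted from 0.\<close>

definition single_edge :: "bool list" where
  "single_edge = [True]"

definition zigzag :: "bool list" where
  "zigzag = [True, False, True]"

definition Qpath :: "nat \<Rightarrow> nat set \<Rightarrow> bool list" where
  "Qpath m S = single_edge @
     concat (map (\<lambda>i. if i \<in> S then single_edge else zigzag) [0..<m]) @ single_edge"

text \<open>\<open>Inner d x p\<close> is the internal vertex at position \<open>p\<close> of the path replacing
  the edge \<open>(d, x)\<close>.\<close>

datatype 'a vertex = Dom 'a | Tup "'a list" | Inner 'a "'a list" nat

definition edge_path :: "'a \<Rightarrow> 'a list \<Rightarrow> bool list" where
  "edge_path d x = Qpath (length x) {i. i < length x \<and> x ! i = d}"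

definition path_vertex :: "'a \<Rightarrow> 'a list \<Rightarrow> nat \<Rightarrow> 'a vertex" where
  "path_vertex d x p =
     (if p = 0 then Dom d else if p = length (edge_path d x) then Tup x else Inner d x p)"

definition dual_tuples :: "'a set \<Rightarrow> 'a cost_fun list \<Rightarrow> 'a list set" where
  "dual_tuples D cs = feas D (combined D cs)"

definition dual_verts :: "'a set \<Rightarrow> 'a cost_fun list \<Rightarrow> 'a vertex set" where
  "dual_verts D cs = Dom ` D \<union> Tup ` dual_tuples D cs \<union>
     {Inner d x p | d x p.
        d \<in> D \<and> x \<in> dual_tuples D cs \<and> 0 < p \<and> p < length (edge_path d x)}"

definition dual_arcs :: "'a set \<Rightarrow> 'a cost_fun list \<Rightarrow> ('a vertex \<times> 'a vertex) set" where
  "dual_arcs D cs =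
     {(if edge_path d x ! p then (path_vertex d x p, path_vertex d x (Suc p))
       else (path_vertex d x (Suc p), path_vertex d x p)) | d x p.
        d \<in> D \<and> x \<in> dual_tuples D cs \<and> p < length (edge_path d x)}"

definition dual_digraph :: "'a set \<Rightarrow> 'a cost_fun list \<Rightarrow> 'a vertex cost_fun" where
  "dual_digraph D cs = digraph_cost (dual_verts D cs) (dual_arcs D cs)"

definition dual_mu :: "'a set \<Rightarrow> 'a cost_fun list \<Rightarrow> 'a vertex cost_fun" where
  "dual_mu D cs =
     (1, restrict (\<lambda>v. case hd v of Tup x \<Rightarrow> snd (combined D cs) x | _ \<Rightarrow> 0)
           (tuples (dual_verts D cs) 1))"

definition extended_dual :: "'a set \<Rightarrow> 'a cost_fun list \<Rightarrow> 'a vertex cost_fun set" where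
  "extended_dual D cs = {dual_digraph D cs, dual_mu D cs}"

definition corresponding ::
    "'a set \<Rightarrow> 'a cost_fun list \<Rightarrow> nat \<Rightarrow> ('a list \<Rightarrow> 'a) \<Rightarrow> ('a vertex list \<Rightarrow> 'a vertex) \<Rightarrow> bool"
  where
  "corresponding D cs k f fe \<longleftrightarrow>
     f \<in> Pol D k (set cs) \<and> fe \<in> Pol (dual_verts D cs) k (extended_dual D cs) \<and>
     (\<forall>xs \<in> tuples (dual_tuples D cs) k.
        fe (map Tup xs) = Tup (app_cw (fst (combined D cs)) f xs)) \<and>
     (\<forall>vs \<in> tuples (dual_verts D cs) k.
        \<not> set vs \<subseteq> Tup ` dual_tuples D cs \<longrightarrow> fe vs \<notin> Tup ` dual_tuples D cs)"

text \<open>Nonnegativity of the combined cost function is needed for \<^const>\<open>dual_mu\<close> to be improved by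
  operations corresponding to those of the language: such an operation of arity at least 2 sends a
  tuple consisting of \<^term>\<open>Tup x\<close> in one position and elements \<^term>\<open>Dom d\<close> elsewhere to a vertex
  of cost 0, while the average cost of the arguments has the sign of the cost of \<open>x\<close>. Adding
  constants to cost functions, which does not affect fractional polymorphisms of the language,
  always achieves it.\<close>

definition nonneg_cost :: "'a set \<Rightarrow> 'a cost_fun \<Rightarrow> bool" where
  "nonneg_cost A c \<longleftrightarrow> (\<forall>x \<in> feas A c. 0 \<le> fin_part (snd c x))"

end

(* Every polymorphism f of the language lifts to the extended dual, and the weights are transported
   along the lifting. Each vertex has a level, its height above D, which goes up by one along every
   arc. A tuple of vertices of equal level on paths from d_i to x_i is sent to the vertex of that
   level on the path from f(d_1,...,d_k) to f(x_1,...,x_k): to the peak of a zigzag if some argument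
   is a peak, to a valley if some argument is a valley (provided that the target has a zigzag there),
   and to the joint of two subpaths otherwise. This respects arcs, because if all paths have a single
   edge for coordinate j, so has the target path. Level differences are constant along arcs, so a
   tuple of vertices of different levels can be projected to its first argument of lowest level.
   Only tuples of elements of D' are sent to D', so the images of all others cost nothing. *)

theory Submission
  imports Defs
begin

section \<open>Tuples and polymorphisms of the combined cost function\<close>

lemma app_cw_take:
  assumes "a \<le> m" shows "take a (app_cw m f xs) = app_cw a f (map (take a) xs)"
  using assms by (auto simp: app_cw_def take_map o_def intro!: nth_equalityI)

text \<open>Unlike for \<open>take\<close>, lengths matter: \<open>drop a x ! i\<close> is
  guaranteed to be \<open>x ! (a + i)\<close> only when \<open>a \<le> length x\<close>.\<close>

lemma app_cw_drop:
  assumes "\<And>x. x \<in> set xs \<Longrightarrow> length x = a + b"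
  shows "drop a (app_cw (a + b) f xs) = app_cw b f (map (drop a) xs)"
  using assms by (intro nth_equalityI) (auto simp: app_cw_def o_def intro!: arg_cong[where f = f])

lemma finite_tuples: "finite A \<Longrightarrow> finite (tuples A k)"
  using finite_lists_length_eq[of A k] by (simp add: tuples_def conj_commute)

lemma finite_Pol: "finite A \<Longrightarrow> finite (Pol A k \<Gamma>)"
  by (rule finite_subset[of _ "operations A k"])
    (auto simp: Pol_def operations_def intro!: finite_PiE finite_tuples)

lemma plus_qbar_eq_Infty: "(a :: qbar) + b = Infty \<longleftrightarrow> a = Infty \<or> b = Infty"
  by (cases a; cases b) auto

lemma fin_part_plus:
  "a \<noteq> Infty \<Longrightarrow> b \<noteq> Infty \<Longrightarrow> fin_part (a + b) = fin_part a + fin_part b"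
  by (cases a; cases b) auto

lemma feas_combined:
  "feas D (combined D cs) =
     {x \<in> tuples D (sum_list (map fst cs)). combined_val cs x \<noteq> Infty}"
  by (auto simp: feas_def combined_def Let_def)

lemma fst_combined: "fst (combined D cs) = sum_list (map fst cs)"
  by (simp add: combined_def Let_def)

text \<open>A sum in \<open>qbar\<close> is finite exactly if both summands are. The inductions over
  the list of cost functions use this to peel off one block at a time.\<close>

lemma feas_combined_Cons:
  "x \<in> feas D (combined D (c # cs)) \<longleftrightarrow>
     length x = fst c + sum_list (map fst cs) \<and>
     take (fst c) x \<in> feas D c \<and> drop (fst c) x \<in> feas D (combined D cs)"
proof -
  have "set x \<subseteq> D \<longleftrightarrow> set (take (fst c) x) \<subseteq> D \<and> set (drop (fst c) x) \<subseteq> D"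
    by (metis append_take_drop_id le_sup_iff set_append)
  then show ?thesis
    by (auto simp: feas_combined tuples_def plus_qbar_eq_Infty feas_def[of D c])
qed

lemma feas_combined_tuples: "feas D (combined D cs) \<subseteq> tuples D (sum_list (map fst cs))"
  by (auto simp: feas_combined)

lemma tuples_map:
  "xs \<in> tuples A k \<Longrightarrow> (\<And>x. x \<in> A \<Longrightarrow> g x \<in> B) \<Longrightarrow> map g xs \<in> tuples B k"
  by (auto simp: tuples_def)

text \<open>Componentwise application commutes with cutting tuples into blocks, and on each block
  \<open>f\<close> preserves feasibility.\<close>

lemma Pol_combined:
  assumes "f \<in> Pol D k (set cs)" "xs \<in> tuples (feas D (combined D cs)) k"
  shows "app_cw (sum_list (map fst cs)) f xs \<in> feas D (combined D cs)"
  using assms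
proof (induction cs arbitrary: xs)
  case Nil
  then show ?case
    by (auto simp: feas_combined zero_qbar_def tuples_def app_cw_def)
next
  case (Cons c cs)
  have len: "length x = fst c + sum_list (map fst cs)" if "x \<in> set xs" for x
    using that Cons.prems(2) by (auto simp: tuples_def feas_combined_Cons)
  have f: "f \<in> Pol D k (set cs)" using Cons.prems(1) by (auto simp: Pol_def)
  have "map (drop (fst c)) xs \<in> tuples (feas D (combined D cs)) k"
    "map (take (fst c)) xs \<in> tuples (feas D c) k"
    by (rule tuples_map[OF Cons.prems(2)], simp add: feas_combined_Cons)+
  with Cons.IH[OF f] Cons.prems(1) show ?case
    unfolding feas_combined_Cons
    by (auto simp: app_cw_take app_cw_drop[OF len] Pol_def)
      (simp add: app_cw_def)
qed

text \<open>The inequalities of the single cost functions add up over the blocks. The language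
  \<Gamma> stays fixed while \<open>cs\<close> shrinks, so that all sums in the induction range over
  the same polymorphisms.\<close>

lemma fractional_combined:
  assumes "fractional_polymorphism D k \<Gamma> \<omega>" "set cs \<subseteq> \<Gamma>"
    and "xs \<in> tuples (feas D (combined D cs)) k"
  shows "(\<Sum>f\<in>Pol D k \<Gamma>. \<omega> f *
        fin_part (combined_val cs (app_cw (sum_list (map fst cs)) f xs)))
      \<le> (1 / of_nat k) * (\<Sum>x\<leftarrow>xs. fin_part (combined_val cs x))"
  using assms(2,3)
proof (induction cs arbitrary: xs)
  case Nil
  then show ?case by (simp add: zero_qbar_def)
next
  case (Cons c cs)
  let ?m = "sum_list (map fst (c # cs))" and ?n = "sum_list (map fst cs)"
  have len: "length x = fst c + sum_list (map fst cs)" if "x \<in> set xs" for x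
    using that Cons.prems(2) by (auto simp: tuples_def feas_combined_Cons)
  have dr: "map (drop (fst c)) xs \<in> tuples (feas D (combined D cs)) k"
    and ta: "map (take (fst c)) xs \<in> tuples (feas D c) k"
    by (rule tuples_map[OF Cons.prems(2)], simp add: feas_combined_Cons)+
  \<comment> \<open>\<open>fin_part\<close> is additive for finite summands, hence the restriction
    to feasible tuples.\<close>
  have split: "fin_part (combined_val (c # cs) x) =
      fin_part (snd c (take (fst c) x)) + fin_part (combined_val cs (drop (fst c) x))"
    if "x \<in> feas D (combined D (c # cs))" for x
    using that by (auto simp: feas_combined_Cons feas_combined feas_def[of D c] plus_qbar_eq_Infty fin_part_plus)
  have image: "app_cw ?m f xs \<in> feas D (combined D (c # cs))" if "f \<in> Pol D k \<Gamma>" for f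
    by (rule Pol_combined) (use that Cons.prems in \<open>auto simp: Pol_def\<close>)
  have "(\<Sum>f\<in>Pol D k \<Gamma>. \<omega> f * fin_part (combined_val (c # cs) (app_cw ?m f xs)))
      = (\<Sum>f\<in>Pol D k \<Gamma>. \<omega> f * fin_part (snd c (app_cw (fst c) f (map (take (fst c)) xs))))
      + (\<Sum>f\<in>Pol D k \<Gamma>. \<omega> f * fin_part (combined_val cs (app_cw ?n f (map (drop (fst c)) xs))))"
    unfolding sum.distrib[symmetric]
  proof (intro sum.cong refl)
    fix f assume "f \<in> Pol D k \<Gamma>"
    then show "\<omega> f * fin_part (combined_val (c # cs) (app_cw ?m f xs)) =
        \<omega> f * fin_part (snd c (app_cw (fst c) f (map (take (fst c)) xs))) +
        \<omega> f * fin_part (combined_val cs (app_cw ?n f (map (drop (fst c)) xs)))"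
      using split[OF image] app_cw_drop[OF len, of xs f]
      by (simp add: app_cw_take distrib_left del: combined_val.simps)
  qed
  also have "\<dots> \<le> (1 / of_nat k) * (\<Sum>x\<leftarrow>map (take (fst c)) xs. fin_part (snd c x))
      + (1 / of_nat k) * (\<Sum>x\<leftarrow>map (drop (fst c)) xs. fin_part (combined_val cs x))"
  proof (rule add_mono)
    have "\<forall>ys \<in> tuples (feas D c) k.
        (\<Sum>f\<in>Pol D k \<Gamma>. \<omega> f * fin_part (snd c (app_cw (fst c) f ys)))
          \<le> (1 / of_nat k) * (\<Sum>x\<leftarrow>ys. fin_part (snd c x))"
      using Cons.prems(1) assms(1) by (simp add: fractional_polymorphism_def)
    then show "(\<Sum>f\<in>Pol D k \<Gamma>. \<omega> f *
          fin_part (snd c (app_cw (fst c) f (map (take (fst c)) xs))))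
        \<le> (1 / of_nat k) * (\<Sum>x\<leftarrow>map (take (fst c)) xs. fin_part (snd c x))"
      using ta by (rule bspec)
  qed (use Cons.IH[OF _ dr] Cons.prems(1) in simp)
  also have "\<dots> = (1 / of_nat k) * (\<Sum>x\<leftarrow>xs. fin_part (combined_val (c # cs) x))"
  proof -
    have eq: "map (\<lambda>x. fin_part (combined_val (c # cs) x)) xs =
        map (\<lambda>x. fin_part (snd c (take (fst c) x)) + fin_part (combined_val cs (drop (fst c) x))) xs"
      using Cons.prems(2) by (auto simp: tuples_def intro!: split simp del: combined_val.simps)
    show ?thesis
      unfolding eq by (simp add: sum_list_addf add_divide_distrib o_def)
  qed
  finally show ?case .
qed


section \<open>Levels in the extended dual\<close>

text \<open>\<open>joint d x j\<close> is the position where the subpath for coordinate \<open>j\<close> begins. The other internal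
  positions of the path are the peak and the valley of the zigzag for each coordinate \<open>j\<close> with
  \<^prop>\<open>x ! j \<noteq> d\<close>, which are at \<open>joint d x j + 1\<close> and \<open>joint d x j + 2\<close>.\<close>

definition joint :: "'a \<Rightarrow> 'a list \<Rightarrow> nat \<Rightarrow> nat" where
  "joint d x j = Suc (\<Sum>i<j. if x ! i = d then 1 else 3)"

text \<open>At the last joint, where the final edge begins, the value is \<open>length x\<close>:
  there \<open>x ! length x\<close> is unspecified, but \<open>joint\<close> grows in either
  case.\<close>

definition segment :: "'a \<Rightarrow> 'a list \<Rightarrow> nat \<Rightarrow> nat" where
  "segment d x p = (LEAST j. p < joint d x (Suc j))"

lemma joint_0 [simp]: "joint d x 0 = 1"
  by (simp add: joint_def)

lemma joint_Suc: "joint d x (Suc j) = joint d x j + (if x ! j = d then 1 else 3)"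
  by (simp add: joint_def)

lemma joint_mono: "i \<le> j \<Longrightarrow> joint d x i \<le> joint d x j"
  by (auto simp: joint_def intro!: sum_mono2)

lemma joint_pos [simp]: "0 < joint d x j"
  by (simp add: joint_def)

lemma segment_eqI:
  assumes "joint d x j \<le> p" "p < joint d x (Suc j)"
  shows "segment d x p = j"
  unfolding segment_def
proof (rule Least_equality)
  fix i assume "p < joint d x (Suc i)"
  with assms(1) show "j \<le> i"
    using joint_mono[of "Suc i" j d x] by (force simp: not_less_eq_eq)
qed (fact assms(2))

lemma segment_joint [simp]: "segment d x (joint d x j) = j"
  by (rule segment_eqI) (auto simp: joint_Suc)

lemma segment_1 [simp]: "segment d x (Suc 0) = 0"
  using segment_joint[of d x 0] by simp

lemma segment_peak [simp]: "x ! j \<noteq> d \<Longrightarrow> segment d x (Suc (joint d x j)) = j"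
  by (rule segment_eqI) (auto simp: joint_Suc)

lemma segment_valley [simp]: "x ! j \<noteq> d \<Longrightarrow> segment d x (Suc (Suc (joint d x j))) = j"
  by (rule segment_eqI) (auto simp: joint_Suc)

text \<open>Induction on \<open>n\<close>: after \<open>joint d x n\<close> come one or three
  positions up to and including the next joint, and the former last joint becomes an ordinary
  one.\<close>

lemma position_cases:
  assumes "0 < p" "p \<le> joint d x n"
  obtains (last) "p = joint d x n"
  | (joint) j where "j < n" "p = joint d x j"
  | (peak) j where "j < n" "x ! j \<noteq> d" "p = Suc (joint d x j)"
  | (valley) j where "j < n" "x ! j \<noteq> d" "p = Suc (Suc (joint d x j))"
  using assms
proof (induction n arbitrary: thesis)
  case 0
  then show ?case by auto
next
  case (Suc n)
  show ?case
  proof (cases "p \<le> joint d x n")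
    case True
    then show ?thesis
      by (rule Suc.IH[rotated 5]) (use Suc.prems in \<open>auto intro: less_SucI\<close>)
  next
    case False
    with Suc.prems(6)
    have "p = joint d x (Suc n) \<or>
        x ! n \<noteq> d \<and> (p = Suc (joint d x n) \<or> p = Suc (Suc (joint d x n)))"
      by (auto simp: joint_Suc split: if_splits)
    with Suc.prems(1,3,4) show ?thesis by blast
  qed
qed

section \<open>Paths and arcs of the extended dual\<close>

lemma length_concat_upt: "length (concat (map g [0..<n])) = (\<Sum>i<n. length (g i))"
  by (induction n) auto

lemma nth_concat_upt:
  assumes "j < m" "r < length (g j)"
  shows "concat (map g [0..<m]) ! ((\<Sum>i<j. length (g i)) + r) = g j ! r"
  using assms
proof (induction m)
  case (Suc m)
  show ?case
  proof (cases "j = m")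
    case True
    then show ?thesis using Suc.prems by (simp add: nth_append length_concat_upt)
  next
    case False
    then have "j < m" using Suc.prems by simp
    moreover have "(\<Sum>i<j. length (g i)) + r < (\<Sum>i<m. length (g i))"
    proof -
      have "(\<Sum>i<j. length (g i)) + r < (\<Sum>i<Suc j. length (g i))" using Suc.prems by simp
      also have "\<dots> \<le> (\<Sum>i<m. length (g i))"
        using \<open>j < m\<close> by (intro sum_mono2) auto
      finally show ?thesis .
    qed
    ultimately show ?thesis using Suc by (simp add: nth_append length_concat_upt)
  qed
qed simp

lemma length_edge_path: "length (edge_path d x) = Suc (joint d x (length x))"
  by (auto simp: edge_path_def Qpath_def single_edge_def zigzag_def joint_def length_concat_upt
      intro!: sum.cong)

lemma edge_path_nth_0: "edge_path d x ! 0"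
  by (simp add: edge_path_def Qpath_def single_edge_def)

lemma edge_path_nth_last: "edge_path d x ! joint d x (length x)"
proof -
  have "last (edge_path d x)" by (simp add: edge_path_def Qpath_def single_edge_def)
  then show ?thesis
    by (metis length_edge_path diff_Suc_1 last_conv_nth length_0_conv nat.distinct(1))
qed

text \<open>Only the middle edge of a zigzag, at offset 1, points backward; a single edge has no
  offset but 0.\<close>

lemma edge_path_nth_segment:
  assumes "j < length x" "r < (if x ! j = d then 1 else 3)"
  shows "edge_path d x ! (joint d x j + r) \<longleftrightarrow> r \<noteq> 1"
proof -
  let ?S = "{i. i < length x \<and> x ! i = d}"
  let ?g = "\<lambda>i. if i \<in> ?S then single_edge else zigzag"
  have sum: "(\<Sum>i<j. length (?g i)) = (\<Sum>i<j. if x ! i = d then 1 else 3)"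
    using assms(1) by (intro sum.cong) (auto simp: single_edge_def zigzag_def)
  have len: "length (concat (map ?g [0..<length x])) = joint d x (length x) - 1"
    using length_edge_path[of d x] by (simp add: edge_path_def Qpath_def single_edge_def)
  \<comment> \<open>The position lies before the final edge, so the lookup falls into the
    concatenation; the initial edge is the \<open>Suc\<close> in \<open>joint\<close>.\<close>
  have "joint d x j + r < joint d x (Suc j)" using assms by (auto simp: joint_Suc)
  also have "\<dots> \<le> joint d x (length x)" using assms by (intro joint_mono) auto
  finally have "(\<Sum>i<j. if x ! i = d then 1 else 3) + r < length (concat (map ?g [0..<length x]))"
    unfolding len by (simp add: joint_def)
  then have "edge_path d x ! (joint d x j + r) =
      concat (map ?g [0..<length x]) ! ((\<Sum>i<j. length (?g i)) + r)"
    unfolding sum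
    by (simp add: edge_path_def Qpath_def single_edge_def joint_def nth_append)
  also have "\<dots> = ?g j ! r"
    using assms by (intro nth_concat_upt) (auto simp: single_edge_def zigzag_def)
  also have "\<dots> \<longleftrightarrow> r \<noteq> 1"
    using assms by (auto simp: single_edge_def zigzag_def less_Suc_eq numeral_3_eq_3)
  finally show ?thesis .
qed

text \<open>Arcs sorted by shape and written from tail to head, so that later case analyses need
  neither positions nor directions: the two end edges, the edge of a coordinate equal to
  \<open>d\<close>, and the three edges of a zigzag.\<close>

inductive dual_arc :: "'a \<Rightarrow> 'a list \<Rightarrow> 'a vertex \<Rightarrow> 'a vertex \<Rightarrow> bool" for d x where
  first: "dual_arc d x (Dom d) (Inner d x (joint d x 0))"
| last: "dual_arc d x (Inner d x (joint d x (length x))) (Tup x)"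
| single: "j < length x \<Longrightarrow> x ! j = d \<Longrightarrow>
    dual_arc d x (Inner d x (joint d x j)) (Inner d x (joint d x (Suc j)))"
| ascent: "j < length x \<Longrightarrow> x ! j \<noteq> d \<Longrightarrow>
    dual_arc d x (Inner d x (joint d x j)) (Inner d x (Suc (joint d x j)))"
| descent: "j < length x \<Longrightarrow> x ! j \<noteq> d \<Longrightarrow>
    dual_arc d x (Inner d x (Suc (Suc (joint d x j)))) (Inner d x (Suc (joint d x j)))"
| reascent: "j < length x \<Longrightarrow> x ! j \<noteq> d \<Longrightarrow>
    dual_arc d x (Inner d x (Suc (Suc (joint d x j)))) (Inner d x (joint d x (Suc j)))"

lemma path_vertex_inner:
  "0 < p \<Longrightarrow> p \<le> joint d x (length x) \<Longrightarrow> path_vertex d x p = Inner d x p"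
  by (simp add: path_vertex_def length_edge_path)

lemma path_vertex_ends:
  "path_vertex d x 0 = Dom d" "path_vertex d x (Suc (joint d x (length x))) = Tup x"
  by (simp_all add: path_vertex_def length_edge_path)

definition path_arc :: "'a \<Rightarrow> 'a list \<Rightarrow> nat \<Rightarrow> 'a vertex \<times> 'a vertex" where
  "path_arc d x p = (if edge_path d x ! p then (path_vertex d x p, path_vertex d x (Suc p))
       else (path_vertex d x (Suc p), path_vertex d x p))"

lemma path_arc_first: "path_arc d x 0 = (Dom d, Inner d x (joint d x 0))"
  using joint_mono[of 0 "length x" d x]
  by (simp add: path_arc_def edge_path_nth_0 path_vertex_ends path_vertex_inner)

lemma path_arc_last:
  "path_arc d x (joint d x (length x)) = (Inner d x (joint d x (length x)), Tup x)"
  by (simp add: path_arc_def edge_path_nth_last path_vertex_ends path_vertex_inner)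

lemma path_arc_segment:
  assumes "j < length x"
  shows "path_arc d x (joint d x j) =
      (Inner d x (joint d x j), Inner d x (Suc (joint d x j)))"
    and "x ! j \<noteq> d \<Longrightarrow> path_arc d x (Suc (joint d x j)) =
      (Inner d x (Suc (Suc (joint d x j))), Inner d x (Suc (joint d x j)))"
    and "x ! j \<noteq> d \<Longrightarrow> path_arc d x (Suc (Suc (joint d x j))) =
      (Inner d x (Suc (Suc (joint d x j))), Inner d x (joint d x (Suc j)))"
proof -
  have le: "joint d x (Suc j) \<le> joint d x (length x)" using assms by (intro joint_mono) auto
  show "path_arc d x (joint d x j) = (Inner d x (joint d x j), Inner d x (Suc (joint d x j)))"
    using le assms edge_path_nth_segment[of j x 0 d]
    by (auto simp: path_arc_def path_vertex_inner joint_Suc split: if_splits)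
  assume "x ! j \<noteq> d"
  then show "path_arc d x (Suc (joint d x j)) =
      (Inner d x (Suc (Suc (joint d x j))), Inner d x (Suc (joint d x j)))"
    and "path_arc d x (Suc (Suc (joint d x j))) =
      (Inner d x (Suc (Suc (joint d x j))), Inner d x (joint d x (Suc j)))"
    using le assms edge_path_nth_segment[of j x 1 d] edge_path_nth_segment[of j x 2 d]
    by (auto simp: path_arc_def path_vertex_inner joint_Suc eval_nat_numeral)
qed

text \<open>Apart from the two end edges, the edge starting at a joint position is of kind
  \<open>single\<close> or \<open>ascent\<close>, at a peak \<open>descent\<close> and at a valley
  \<open>reascent\<close>.\<close>

lemma dual_arc_iff_path_arc:
  "dual_arc d x u v \<longleftrightarrow> (\<exists>p < length (edge_path d x). (u, v) = path_arc d x p)"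
proof
  have less: "joint d x (Suc j) < length (edge_path d x)" if "j < length x" for j
    using joint_mono[of "Suc j" "length x" d x] that by (simp add: length_edge_path)
  assume "dual_arc d x u v"
  then show "\<exists>p < length (edge_path d x). (u, v) = path_arc d x p"
  proof cases
    case first
    then show ?thesis by (intro exI[of _ 0]) (simp add: path_arc_first length_edge_path)
  next
    case last
    then show ?thesis
      by (intro exI[of _ "joint d x (length x)"]) (simp add: path_arc_last length_edge_path)
  next
    case (single j)
    then show ?thesis using less[of j]
      by (intro exI[of _ "joint d x j"]) (simp add: path_arc_segment joint_Suc)
  next
    case (ascent j)
    then show ?thesis using less[of j]
      by (intro exI[of _ "joint d x j"]) (simp add: path_arc_segment joint_Suc)
  next
    case (descent j)
    then show ?thesis using less[of j]
      by (intro exI[of _ "Suc (joint d x j)"]) (simp add: path_arc_segment joint_Suc)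
  next
    case (reascent j)
    then show ?thesis using less[of j]
      by (intro exI[of _ "Suc (Suc (joint d x j))"]) (simp add: path_arc_segment joint_Suc)
  qed
next
  assume "\<exists>p < length (edge_path d x). (u, v) = path_arc d x p"
  then obtain p where p: "p < length (edge_path d x)" "(u, v) = path_arc d x p" by blast
  show "dual_arc d x u v"
  proof (cases "p = 0")
    case True
    then show ?thesis using p first[of d x] by (simp add: path_arc_first)
  next
    case False
    then have "0 < p" "p \<le> joint d x (length x)" using p by (auto simp: length_edge_path)
    then show ?thesis
    proof (cases rule: position_cases)
      case last
      then show ?thesis using p by (simp add: path_arc_last dual_arc.last)
    next
      case (joint j)
      then show ?thesis
        using p single[of j x d] ascent[of j x d]
        by (cases "x ! j = d") (simp_all add: path_arc_segment joint_Suc)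
    next
      case (peak j)
      then show ?thesis using p by (simp add: path_arc_segment descent)
    next
      case (valley j)
      then show ?thesis using p by (simp add: path_arc_segment reascent)
    qed
  qed
qed

lemma dual_arcs_iff:
  "(u, v) \<in> dual_arcs D cs \<longleftrightarrow> (\<exists>d\<in>D. \<exists>x\<in>dual_tuples D cs. dual_arc d x u v)"
  unfolding dual_arcs_def dual_arc_iff_path_arc path_arc_def by blast

section \<open>Vertices and their levels\<close>

lemma dual_tuples_length: "x \<in> dual_tuples D cs \<Longrightarrow> length x = sum_list (map fst cs)"
  using feas_combined_tuples by (fastforce simp: dual_tuples_def tuples_def)

lemma Inner_dual_verts:
  "Inner d x p \<in> dual_verts D cs \<longleftrightarrow>
     d \<in> D \<and> x \<in> dual_tuples D cs \<and> 0 < p \<and> p \<le> joint d x (length x)"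
  by (auto simp: dual_verts_def length_edge_path)

lemma Dom_dual_verts: "Dom d \<in> dual_verts D cs \<longleftrightarrow> d \<in> D"
  by (auto simp: dual_verts_def)

lemma Tup_dual_verts: "Tup x \<in> dual_verts D cs \<longleftrightarrow> x \<in> dual_tuples D cs"
  by (auto simp: dual_verts_def)

lemmas vertex_in_dual_verts = Inner_dual_verts Dom_dual_verts Tup_dual_verts

text \<open>Joint \<open>j\<close> has height \<open>j + 1\<close>. A zigzag for coordinate
  \<open>j\<close> climbs from there to its peak at \<open>j + 2\<close>, falls to its valley at
  \<open>j + 1\<close> and climbs to the next joint at \<open>j + 2\<close>, the same net gain as a
  single edge.\<close>

primrec level :: "'a vertex \<Rightarrow> nat" where
  "level (Dom d) = 0"
| "level (Tup x) = length x + 2"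
| "level (Inner d x p) =
     segment d x p + (if p = Suc (joint d x (segment d x p)) then 2 else 1)"

text \<open>If coordinate \<open>j\<close> is a single edge, the position after
  \<open>joint d x j\<close> already belongs to the next segment, so the equation singles out
  zigzags. The same holds for \<open>valley\<close>.\<close>

primrec peak :: "'a vertex \<Rightarrow> bool" where
  "peak (Dom d) \<longleftrightarrow> False"
| "peak (Tup x) \<longleftrightarrow> False"
| "peak (Inner d x p) \<longleftrightarrow> p = Suc (joint d x (segment d x p))"

primrec valley :: "'a vertex \<Rightarrow> bool" where
  "valley (Dom d) \<longleftrightarrow> False"
| "valley (Tup x) \<longleftrightarrow> False"
| "valley (Inner d x p) \<longleftrightarrow> p = Suc (Suc (joint d x (segment d x p)))"

text \<open>A vertex in D' ends paths from every element of D and determines none of them; at the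
  top level \<open>lift_vertex\<close> ignores this value. The bottom level is treated likewise in
  \<open>tup_part\<close>.\<close>

primrec dom_part :: "'a vertex \<Rightarrow> 'a" where
  "dom_part (Dom d) = d"
| "dom_part (Tup x) = undefined"
| "dom_part (Inner d x p) = d"

primrec tup_part :: "'a vertex \<Rightarrow> 'a list" where
  "tup_part (Dom d) = undefined"
| "tup_part (Tup x) = x"
| "tup_part (Inner d x p) = x"

lemma dual_verts_cases:
  assumes "v \<in> dual_verts D cs"
  obtains (Dom) d where "d \<in> D" "v = Dom d" "level v = 0" "\<not> peak v" "\<not> valley v"
  | (Tup) x where "x \<in> dual_tuples D cs" "v = Tup x" "level v = length x + 2"
      "\<not> peak v" "\<not> valley v"
  | (joint) d x j where "d \<in> D" "x \<in> dual_tuples D cs" "j \<le> length x"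
      "v = Inner d x (joint d x j)" "level v = Suc j" "\<not> peak v" "\<not> valley v"
  | (peak) d x j where "d \<in> D" "x \<in> dual_tuples D cs" "j < length x"
      "v = Inner d x (Suc (joint d x j))" "level v = Suc (Suc j)" "peak v" "\<not> valley v"
  | (valley) d x j where "d \<in> D" "x \<in> dual_tuples D cs" "j < length x"
      "v = Inner d x (Suc (Suc (joint d x j)))" "level v = Suc j" "\<not> peak v" "valley v"
proof (cases v)
  case (Dom d)
  then show thesis using that(1) assms by (simp add: vertex_in_dual_verts)
next
  case (Tup x)
  then show thesis using that(2) assms by (simp add: vertex_in_dual_verts)
next
  case (Inner d x p)
  then have v: "d \<in> D" "x \<in> dual_tuples D cs" and p: "0 < p" "p \<le> joint d x (length x)"
    using assms by (auto simp: vertex_in_dual_verts)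
  from p show thesis
    by (cases rule: position_cases)
      (use Inner v in \<open>auto intro: that(3)[OF _ _ less_imp_le] that(3-5)\<close>)
qed

lemma dual_arc_level: "dual_arc d x u v \<Longrightarrow> level v = Suc (level u)"
  by (cases rule: dual_arc.cases) auto

lemma dual_arc_verts:
  assumes "dual_arc d x u v" "d \<in> D" "x \<in> dual_tuples D cs"
  shows "u \<in> dual_verts D cs \<and> v \<in> dual_verts D cs"
proof -
  have J: "Inner d x (joint d x j) \<in> dual_verts D cs" if "j \<le> length x" for j
    using assms(2,3) joint_mono[OF that, of d x] by (simp add: vertex_in_dual_verts)
  have Z: "Inner d x (Suc (joint d x j)) \<in> dual_verts D cs"
    "Inner d x (Suc (Suc (joint d x j))) \<in> dual_verts D cs"
    if "j < length x" "x ! j \<noteq> d" for j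
    using assms(2,3) joint_mono[OF Suc_leI[OF that(1)], of d x] that(2)
    by (simp_all add: vertex_in_dual_verts joint_Suc)
  show ?thesis
    using assms(1)
  proof cases
    case first
    then show ?thesis using J[of 0] assms(2) by (simp add: vertex_in_dual_verts)
  next
    case last
    then show ?thesis using J[of "length x"] assms(3) by (simp add: vertex_in_dual_verts)
  qed (use J Z in simp_all)
qed


section \<open>Lifting operations to the extended dual\<close>

text \<open>Ties go to the first index, so the choice depends only on the order of the levels and
  survives raising all of them by one.\<close>

definition lowest :: "nat list \<Rightarrow> nat" where
  "lowest ls = (LEAST i. i < length ls \<and> (\<forall>l \<in> set ls. ls ! i \<le> l))"

lemma lowest:
  assumes "ls \<noteq> []"
  shows "lowest ls < length ls" "\<forall>l \<in> set ls. ls ! lowest ls \<le> l"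
proof -
  have "Min (set ls) \<in> set ls" using assms by simp
  then obtain i where "i < length ls" "ls ! i = Min (set ls)" by (auto simp: in_set_conv_nth)
  then have "i < length ls \<and> (\<forall>l \<in> set ls. ls ! i \<le> l)" by simp
  then have "lowest ls < length ls \<and> (\<forall>l \<in> set ls. ls ! lowest ls \<le> l)"
    unfolding lowest_def by (rule LeastI)
  then show "lowest ls < length ls" "\<forall>l \<in> set ls. ls ! lowest ls \<le> l" by blast+
qed

lemma lowest_map_Suc: "lowest (map Suc ls) = lowest ls"
  unfolding lowest_def by (intro arg_cong[where f = Least]) auto

text \<open>A peak at level \<open>l\<close> belongs to coordinate \<open>l - 2\<close>, a valley or
  joint to \<open>l - 1\<close>. Preferring peaks over valleys does no harm to arcs: a peak is never
  a tail and a valley never a head, so a tuple containing both takes part in no tuple of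
  arcs.\<close>

definition lift_vertex :: "'a \<Rightarrow> 'a list \<Rightarrow> nat \<Rightarrow> bool \<Rightarrow> bool \<Rightarrow> 'a vertex" where
  "lift_vertex d x l up down =
     (if l = 0 then Dom d
      else if l = length x + 2 then Tup x
      else if up \<and> x ! (l - 2) \<noteq> d then Inner d x (Suc (joint d x (l - 2)))
      else if down \<and> x ! (l - 1) \<noteq> d then Inner d x (Suc (Suc (joint d x (l - 1))))
      else Inner d x (joint d x (l - 1)))"

definition lift_op :: "nat \<Rightarrow> ('a list \<Rightarrow> 'a) \<Rightarrow> 'a vertex list \<Rightarrow> 'a vertex" where
  "lift_op m f vs =
     (if \<forall>v \<in> set vs. level v = level (hd vs)
      then lift_vertex (f (map dom_part vs)) (app_cw m f (map tup_part vs)) (level (hd vs))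
        (\<exists>v \<in> set vs. peak v) (\<exists>v \<in> set vs. valley v)
      else vs ! lowest (map level vs))"

lemma dom_part_dual_verts:
  "v \<in> dual_verts D cs \<Longrightarrow> level v \<noteq> sum_list (map fst cs) + 2 \<Longrightarrow> dom_part v \<in> D"
  by (cases v) (auto simp: vertex_in_dual_verts dual_tuples_length)

lemma tup_part_dual_verts:
  "v \<in> dual_verts D cs \<Longrightarrow> level v \<noteq> 0 \<Longrightarrow> tup_part v \<in> dual_tuples D cs"
  by (cases v) (auto simp: vertex_in_dual_verts)

text \<open>\<open>f\<close> maps the parts into D and D' wherever they are defined. Peaks and
  valleys occur only at levels that name an actual coordinate, so the chosen position lies on the
  target path.\<close>

lemma lift_op_verts:
  assumes f: "f \<in> Pol D k (set cs)" and k: "0 < k" and vs: "vs \<in> tuples (dual_verts D cs) k"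
  shows "lift_op (sum_list (map fst cs)) f vs \<in> dual_verts D cs" (is "lift_op ?m f vs \<in> ?V")
proof (cases "\<forall>v \<in> set vs. level v = level (hd vs)")
  case False
  have "lowest (map level vs) < length vs" using lowest(1)[of "map level vs"] k vs
    by (auto simp: tuples_def)
  then show ?thesis using False vs by (auto simp: lift_op_def tuples_def)
next
  case True
  define l d x where "l = level (hd vs)" and "d = f (map dom_part vs)"
    and "x = app_cw ?m f (map tup_part vs)"
  have lev: "level v = l" if "v \<in> set vs" for v using True that l_def by blast
  have V: "v \<in> ?V" if "v \<in> set vs" for v using vs that by (auto simp: tuples_def)
  have hd: "hd vs \<in> set vs" using k vs by (auto simp: tuples_def)
  have d: "d \<in> D" if "l \<noteq> ?m + 2"
  proof -
    have "map dom_part vs \<in> tuples D k"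
      using vs that V lev dom_part_dual_verts by (fastforce simp: tuples_def)
    then show ?thesis using f by (auto simp: d_def Pol_def operations_def)
  qed
  have x: "x \<in> dual_tuples D cs" if "l \<noteq> 0"
  proof -
    have "map tup_part vs \<in> tuples (dual_tuples D cs) k"
      using vs that V lev tup_part_dual_verts by (fastforce simp: tuples_def)
    then show ?thesis using Pol_combined[OF f] by (simp add: x_def dual_tuples_def)
  qed
  have len: "length x = ?m" by (simp add: x_def app_cw_def)
  have l: "l \<le> ?m + 2" using V[OF hd] unfolding l_def
    by (cases rule: dual_verts_cases) (auto simp: dual_tuples_length)
  \<comment> \<open>These bounds keep \<open>l - 2\<close> from being truncated and keep
    \<open>l - 1\<close> below the number of coordinates.\<close>
  have peak: "2 \<le> l" if "v \<in> set vs" "peak v" for v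
    using V[OF that(1)] lev[OF that(1)] that(2) by (cases rule: dual_verts_cases) auto
  have valley: "l \<le> ?m" if "v \<in> set vs" "valley v" for v
    using V[OF that(1)] lev[OF that(1)] that(2)
    by (cases rule: dual_verts_cases) (auto simp: dual_tuples_length)
  have le: "joint d x (Suc j) \<le> joint d x (length x)" if "j < length x" for j
    using that by (intro joint_mono) auto
  have "lift_vertex d x l (\<exists>v \<in> set vs. peak v) (\<exists>v \<in> set vs. valley v) \<in> ?V"
  proof -
    consider "l = 0" | "l = ?m + 2" | "0 < l" "l < ?m + 2" using l by linarith
    then show ?thesis
    proof cases
      case 3
      have "Suc (joint d x (l - 2)) \<le> joint d x (length x)"
        if "v \<in> set vs" "peak v" "x ! (l - 2) \<noteq> d" for v
      proof -
        have "l - 2 < ?m" using peak[OF that(1,2)] 3 by linarith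
        then show ?thesis using le[of "l - 2"] that(3) len by (simp add: joint_Suc)
      qed
      moreover have "Suc (Suc (joint d x (l - 1))) \<le> joint d x (length x)"
        if "v \<in> set vs" "valley v" "x ! (l - 1) \<noteq> d" for v
      proof -
        have "l - 1 < ?m" using valley[OF that(1,2)] 3 by linarith
        then show ?thesis using le[of "l - 1"] that(3) len by (simp add: joint_Suc)
      qed
      moreover have "joint d x (l - 1) \<le> joint d x (length x)"
        using 3 len by (intro joint_mono) auto
      ultimately show ?thesis
        using 3 d x len by (auto simp: lift_vertex_def vertex_in_dual_verts)
    qed (use d x len in \<open>auto simp: lift_vertex_def vertex_in_dual_verts\<close>)
  qed
  then show ?thesis using True by (simp add: lift_op_def l_def d_def x_def)
qed

text \<open>For the last claim: between internal vertices, an arc whose tail is no valley and whose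
  head is no peak can only be of kind \<open>single\<close>.\<close>

lemma dual_arc_same_parts:
  assumes "dual_arc d x u v"
  shows "level v \<noteq> length x + 2 \<Longrightarrow> dom_part u = d \<and> dom_part v = d"
    and "level u \<noteq> 0 \<Longrightarrow> tup_part u = x \<and> tup_part v = x"
    and "level u = 0 \<Longrightarrow> u = Dom d \<and> v = Inner d x (joint d x 0)"
    and "level v = length x + 2 \<Longrightarrow> u = Inner d x (joint d x (length x)) \<and> v = Tup x"
    and "\<not> valley v" "\<not> peak u"
    and "level u \<noteq> 0 \<Longrightarrow> level v \<noteq> length x + 2 \<Longrightarrow> \<not> valley u \<Longrightarrow> \<not> peak v \<Longrightarrow>
      x ! (level u - 1) = d"
  using assms by (cases, auto)+

text \<open>The arcs are indexed by one list \<open>ps\<close>, so that tails and heads are two maps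
  over it.\<close>

lemma lift_op_arc:
  assumes f: "f \<in> Pol D k (set cs)" and k: "0 < k" and ps: "length ps = k"
    and arcs: "\<And>p. p \<in> set ps \<Longrightarrow> (a p, b p) \<in> dual_arcs D cs"
  shows "(lift_op (sum_list (map fst cs)) f (map a ps),
      lift_op (sum_list (map fst cs)) f (map b ps)) \<in> dual_arcs D cs"
    (is "(lift_op ?m f _, _) \<in> _")
proof -
  have hd: "hd ps \<in> set ps" using k ps by auto
  then have hd_map: "hd (map g ps) = g (hd ps)" for g :: "'b \<Rightarrow> 'a vertex"
    by (metis empty_iff hd_map list.set(1))
  have "\<forall>p \<in> set ps. \<exists>d x. d \<in> D \<and> x \<in> dual_tuples D cs \<and> dual_arc d x (a p) (b p)"
    using arcs unfolding dual_arcs_iff by blast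
  then obtain d x where d: "\<And>p. p \<in> set ps \<Longrightarrow> d p \<in> D"
    and x: "\<And>p. p \<in> set ps \<Longrightarrow> x p \<in> dual_tuples D cs"
    and arc: "\<And>p. p \<in> set ps \<Longrightarrow> dual_arc (d p) (x p) (a p) (b p)"
    by metis
  have len: "length (x p) = ?m" if "p \<in> set ps" for p using x[OF that] by (rule dual_tuples_length)
  have lev: "level (b p) = Suc (level (a p))" if "p \<in> set ps" for p
    using arc[OF that] by (rule dual_arc_level)
  have parts: "\<not> valley (b p)" "\<not> peak (a p)" if "p \<in> set ps" for p
    using dual_arc_same_parts[OF arc[OF that]] by auto
  show ?thesis
  proof (cases "\<forall>p \<in> set ps. level (a p) = level (a (hd ps))")
    case False
    then have nb: "\<not> (\<forall>p \<in> set ps. level (b p) = level (b (hd ps)))"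
      using lev hd by auto
    \<comment> \<open>Tails and heads are projected to the same index, so the image is one of the
      given arcs.\<close>
    have "map level (map b ps) = map Suc (map level (map a ps))" using lev by simp
    then have eq: "lowest (map level (map b ps)) = lowest (map level (map a ps))"
      by (simp only: lowest_map_Suc)
    have "lowest (map level (map a ps)) < length ps"
      using lowest(1)[of "map level (map a ps)"] k ps by auto
    moreover have "lift_op ?m f (map a ps) = map a ps ! lowest (map level (map a ps))"
      using False by (auto simp: lift_op_def hd_map)
    moreover have "lift_op ?m f (map b ps) = map b ps ! lowest (map level (map b ps))"
      using nb by (auto simp: lift_op_def hd_map)
    ultimately show ?thesis using eq arcs by simp
  next
    case True
    define l where "l = level (a (hd ps))"
    define e where "e = f (map d ps)"
    define y where "y = app_cw ?m f (map x ps)"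
    have la: "level (a p) = l" if "p \<in> set ps" for p using True that l_def by blast
    have lb: "level (b p) = Suc l" if "p \<in> set ps" for p using la lev that by auto
    have e: "e \<in> D"
    proof -
      have "map d ps \<in> tuples D k" using ps d by (auto simp: tuples_def)
      then show ?thesis using f by (auto simp: e_def Pol_def operations_def)
    qed
    have y: "y \<in> dual_tuples D cs"
    proof -
      have "map x ps \<in> tuples (dual_tuples D cs) k" using ps x by (auto simp: tuples_def)
      then show ?thesis using Pol_combined[OF f] by (simp add: y_def dual_tuples_def)
    qed
    have leny: "length y = ?m" by (simp add: y_def app_cw_def)
    \<comment> \<open>A tail is never in D' and a head never in D, so these two parts are always
      defined. The other two need the level to be excluded at the top or the bottom.\<close>
    have da: "map (dom_part \<circ> a) ps = map d ps"
    proof (rule map_cong[OF refl])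
      fix p assume p: "p \<in> set ps"
      show "(dom_part \<circ> a) p = d p"
        using dual_arc_same_parts[OF arc[OF p]] by (cases "level (b p) = length (x p) + 2") auto
    qed
    have xb: "map (tup_part \<circ> b) ps = map x ps"
    proof (rule map_cong[OF refl])
      fix p assume p: "p \<in> set ps"
      show "(tup_part \<circ> b) p = x p"
        using dual_arc_same_parts[OF arc[OF p]] by (cases "level (a p) = 0") auto
    qed
    have db: "map (dom_part \<circ> b) ps = map d ps" if "Suc l \<noteq> ?m + 2"
      using dual_arc_same_parts(1)[OF arc] lb len that by auto
    have xa: "map (tup_part \<circ> a) ps = map x ps" if "l \<noteq> 0"
      using dual_arc_same_parts(2)[OF arc] la that by auto
    have A: "lift_op ?m f (map a ps) =
        lift_vertex e (app_cw ?m f (map (tup_part \<circ> a) ps)) l False (\<exists>p \<in> set ps. valley (a p))"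
      using True parts by (simp add: lift_op_def hd_map l_def da e_def)
    have B: "lift_op ?m f (map b ps) =
        lift_vertex (f (map (dom_part \<circ> b) ps)) y (Suc l) (\<exists>p \<in> set ps. peak (b p)) False"
      using lb lb[OF hd] parts by (simp add: lift_op_def hd_map xb y_def)
    have "dual_arc e y (lift_op ?m f (map a ps)) (lift_op ?m f (map b ps))"
    proof -
      have "level (b (hd ps)) \<le> ?m + 2"
        using dual_arc_verts[OF arc[OF hd] d[OF hd] x[OF hd], THEN conjunct2]
        by (cases rule: dual_verts_cases) (auto simp: dual_tuples_length)
      then have "Suc l \<le> ?m + 2" using lb[OF hd] by simp
      then consider "l = 0" | "l = Suc ?m" | j where "l = Suc j" "j < ?m"
        by (cases l) force+
      then show ?thesis
      proof cases
        case 1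
        \<comment> \<open>All heads are first joints, so their image is the first joint of the
          target path.\<close>
        have "\<not> peak (b p)" if "p \<in> set ps" for p
          using dual_arc_same_parts(3)[OF arc[OF that]] la[OF that] 1
          by (metis segment_joint peak.simps(3) n_not_Suc_n)
        then show ?thesis
          using 1 A B db leny dual_arc.first[of e y] by (simp add: lift_vertex_def e_def)
      next
        case 2
        have "\<not> valley (a p)" if "p \<in> set ps" for p
          using dual_arc_same_parts(4)[OF arc[OF that]] lb[OF that] 2 len[OF that] by auto
        then show ?thesis
          using 2 A B xa leny dual_arc.last[of e y]
          by (simp add: lift_vertex_def y_def[symmetric])
      next
        case (3 j)
        have A': "lift_op ?m f (map a ps) =
            lift_vertex e y l False (\<exists>p \<in> set ps. valley (a p))"
          using A xa 3 by (simp add: y_def)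
        have B': "lift_op ?m f (map b ps) =
            lift_vertex e y (Suc l) (\<exists>p \<in> set ps. peak (b p)) False"
          using B db 3 by (simp add: e_def)
        \<comment> \<open>Going from joint to joint across a zigzag would be no arc. If no tail is a
          valley and no head a peak, all given arcs are single edges, and applying \<open>f\<close>
          to their coordinates \<open>j\<close> makes the target edge single too.\<close>
        have "\<exists>p \<in> set ps. valley (a p) \<or> peak (b p)" if "y ! j \<noteq> e"
        proof (rule ccontr)
          assume *: "\<not> (\<exists>p \<in> set ps. valley (a p) \<or> peak (b p))"
          have "x p ! j = d p" if "p \<in> set ps" for p
            using dual_arc_same_parts(7)[OF arc[OF that]] la[OF that] lb[OF that] 3 len[OF that] *
              that by auto
          then have eq: "map (\<lambda>p. x p ! j) ps = map d ps" by simp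
          have "y ! j = f (map (\<lambda>p. x p ! j) ps)"
            using 3 by (simp add: y_def app_cw_def o_def)
          with that show False unfolding eq e_def by simp
        qed
        \<comment> \<open>If \<open>y ! j = e\<close>, the arc is \<open>single\<close>. Otherwise a
          peak alone gives \<open>ascent\<close>, a valley alone \<open>reascent\<close>, and both
          together \<open>descent\<close>.\<close>
        then show ?thesis
          using 3 leny dual_arc.intros(3-6)[of j y e] unfolding A' B'
          by (auto simp: lift_vertex_def)
      qed
    qed
    then show ?thesis using e y unfolding dual_arcs_iff by blast
  qed
qed

section \<open>Values of the lift on D and D'\<close>

lemma lift_op_Tup:
  assumes "0 < k" "xs \<in> tuples (dual_tuples D cs) k"
  shows "lift_op (sum_list (map fst cs)) f (map Tup xs) =
    Tup (app_cw (sum_list (map fst cs)) f xs)"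
proof -
  have len: "\<forall>x \<in> set xs. length x = sum_list (map fst cs)"
    using assms(2) dual_tuples_length by (fastforce simp: tuples_def)
  moreover have ne: "xs \<noteq> []" using assms by (auto simp: tuples_def)
  ultimately have "length (hd xs) = sum_list (map fst cs)" by simp
  then show ?thesis using len ne
    by (simp add: lift_op_def lift_vertex_def hd_map o_def app_cw_def)
qed

lemma lift_op_Dom:
  assumes "ds \<noteq> []"
  shows "lift_op m f (map Dom ds) = Dom (f ds)"
  using assms by (simp add: lift_op_def lift_vertex_def hd_map o_def)

text \<open>Only the top level consists of tuples, and the lowest argument is at that level only if all
  arguments are.\<close>

lemma lift_op_not_Tup:
  assumes k: "0 < k" and vs: "vs \<in> tuples (dual_verts D cs) k"
    and "\<not> set vs \<subseteq> Tup ` dual_tuples D cs"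
  shows "lift_op (sum_list (map fst cs)) f vs \<noteq> Tup z"
proof -
  let ?m = "sum_list (map fst cs)"
  have V: "v \<in> dual_verts D cs" if "v \<in> set vs" for v using vs that by (auto simp: tuples_def)
  have lt: "v \<in> Tup ` dual_tuples D cs \<or> level v < ?m + 2" if "v \<in> set vs" for v
    using V[OF that] by (cases rule: dual_verts_cases) (auto simp: dual_tuples_length)
  obtain w where w: "w \<in> set vs" "w \<notin> Tup ` dual_tuples D cs" using assms(3) by blast
  then have "level w < ?m + 2" using lt by blast
  show ?thesis
  proof (cases "\<forall>v \<in> set vs. level v = level (hd vs)")
    case True
    then have "level (hd vs) < ?m + 2" using w \<open>level w < ?m + 2\<close> by auto
    then show ?thesis using True by (auto simp: lift_op_def lift_vertex_def app_cw_def)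
  next
    case False
    let ?v = "vs ! lowest (map level vs)"
    have "vs \<noteq> []" using w by auto
    then have i: "lowest (map level vs) < length vs" "level ?v \<le> level w"
      using lowest[of "map level vs"] w by auto
    then have "?v \<in> dual_verts D cs" using V by simp
    then have "?v \<noteq> Tup z"
      using i(2) \<open>level w < ?m + 2\<close> by (auto simp: vertex_in_dual_verts dual_tuples_length)
    then show ?thesis using False by (auto simp: lift_op_def)
  qed
qed

section \<open>Lifts as polymorphisms of the extended dual\<close>

definition lift_dual :: "'a set \<Rightarrow> 'a cost_fun list \<Rightarrow> nat \<Rightarrow> ('a list \<Rightarrow> 'a) \<Rightarrow>
    'a vertex list \<Rightarrow> 'a vertex" where
  "lift_dual D cs k f =
     restrict (lift_op (sum_list (map fst cs)) f) (tuples (dual_verts D cs) k)"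

lemma fst_extended_dual: "fst (dual_digraph D cs) = 2" "fst (dual_mu D cs) = 1"
  by (simp_all add: dual_digraph_def digraph_cost_def dual_mu_def)

lemma feas_dual_digraph:
  "xs \<in> feas (dual_verts D cs) (dual_digraph D cs) \<longleftrightarrow>
     (\<exists>u v. xs = [u, v] \<and> (u, v) \<in> dual_arcs D cs)"
proof -
  have verts: "u \<in> dual_verts D cs \<and> v \<in> dual_verts D cs" if "(u, v) \<in> dual_arcs D cs" for u v
    using that dual_arc_verts unfolding dual_arcs_iff by metis
  have "xs \<in> feas (dual_verts D cs) (dual_digraph D cs) \<longleftrightarrow>
      xs \<in> tuples (dual_verts D cs) 2 \<and> (xs ! 0, xs ! 1) \<in> dual_arcs D cs"
    by (auto simp: feas_def dual_digraph_def digraph_cost_def split: if_splits)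
  also have "\<dots> \<longleftrightarrow> (\<exists>u v. xs = [u, v] \<and> (u, v) \<in> dual_arcs D cs)"
  proof
    assume *: "xs \<in> tuples (dual_verts D cs) 2 \<and> (xs ! 0, xs ! 1) \<in> dual_arcs D cs"
    then obtain u v where "xs = [u, v]"
      by (auto simp: tuples_def numeral_2_eq_2 length_Suc_conv)
    with * show "\<exists>u v. xs = [u, v] \<and> (u, v) \<in> dual_arcs D cs" by auto
  next
    assume "\<exists>u v. xs = [u, v] \<and> (u, v) \<in> dual_arcs D cs"
    then show "xs \<in> tuples (dual_verts D cs) 2 \<and> (xs ! 0, xs ! 1) \<in> dual_arcs D cs"
      using verts by (auto simp: tuples_def)
  qed
  finally show ?thesis .
qed

lemma dual_mu_singleton:
  "v \<in> dual_verts D cs \<Longrightarrow>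
     snd (dual_mu D cs) [v] = (case v of Tup x \<Rightarrow> combined_val cs x | _ \<Rightarrow> 0)"
  using feas_combined_tuples
  by (fastforce simp: dual_mu_def tuples_def combined_def Let_def vertex_in_dual_verts
      dual_tuples_def split: vertex.splits)

text \<open>D' holds feasible tuples only, so no vertex has infinite cost, and preserving
  \<open>dual_mu\<close> amounts to mapping into the vertex set.\<close>

lemma feas_dual_mu:
  "xs \<in> feas (dual_verts D cs) (dual_mu D cs) \<longleftrightarrow> (\<exists>v \<in> dual_verts D cs. xs = [v])"
proof -
  have "snd (dual_mu D cs) [v] \<noteq> Infty" if "v \<in> dual_verts D cs" for v
    using that dual_mu_singleton[OF that]
    by (auto simp: zero_qbar_def vertex_in_dual_verts dual_tuples_def feas_combined
        split: vertex.splits)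
  then show ?thesis
    by (auto simp: feas_def tuples_def fst_extended_dual length_Suc_conv)
qed

lemma lift_dual_Pol:
  assumes f: "f \<in> Pol D k (set cs)" and k: "0 < k"
  shows "lift_dual D cs k f \<in> Pol (dual_verts D cs) k (extended_dual D cs)"
proof -
  let ?V = "dual_verts D cs" and ?F = "lift_dual D cs k f"
  have into: "?F vs \<in> ?V" if "vs \<in> tuples ?V k" for vs
    using lift_op_verts[OF f k that] that by (simp add: lift_dual_def)
  have "app_cw 2 ?F xs \<in> feas ?V (dual_digraph D cs)"
    if xs: "xs \<in> tuples (feas ?V (dual_digraph D cs)) k" for xs
  proof -
    have arcs: "(x ! 0, x ! 1) \<in> dual_arcs D cs" if "x \<in> set xs" for x
    proof -
      have "x \<in> feas ?V (dual_digraph D cs)" using that xs by (auto simp: tuples_def)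
      then show ?thesis by (auto simp: feas_dual_digraph)
    qed
    have "map (\<lambda>x. x ! i) xs \<in> tuples ?V k" if "i < 2" for i
      by (rule tuples_map[OF xs])
        (use that in \<open>auto simp: feas_def tuples_def fst_extended_dual subset_iff\<close>)
    moreover have "length xs = k" using xs by (simp add: tuples_def)
    ultimately show ?thesis
      \<comment> \<open>The pairs in \<open>xs\<close> serve as the index list, with their two
        entries as tail and head.\<close>
      using lift_op_arc[OF f k _ arcs, of xs]
      by (simp add: app_cw_def feas_dual_digraph lift_dual_def numeral_2_eq_2)
  qed
  moreover have "app_cw 1 ?F xs \<in> feas ?V (dual_mu D cs)"
    if xs: "xs \<in> tuples (feas ?V (dual_mu D cs)) k" for xs
  proof -
    have "map (\<lambda>x. x ! 0) xs \<in> tuples ?V k"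
      by (rule tuples_map[OF xs]) (auto simp: feas_dual_mu)
    then show ?thesis using into by (simp add: app_cw_def feas_dual_mu)
  qed
  ultimately show ?thesis
    using into by (auto simp: Pol_def operations_def extended_dual_def fst_extended_dual
        lift_dual_def)
qed

lemma lift_dual_corresponding:
  assumes f: "f \<in> Pol D k (set cs)" and k: "0 < k"
  shows "corresponding D cs k f (lift_dual D cs k f)"
proof -
  have "map Tup xs \<in> tuples (dual_verts D cs) k" if "xs \<in> tuples (dual_tuples D cs) k" for xs
    using that by (rule tuples_map) (simp add: vertex_in_dual_verts)
  then show ?thesis
    using lift_op_Tup[OF k, of _ D cs f] lift_op_not_Tup[OF k, of _ D cs f] f lift_dual_Pol[OF f k]
    unfolding corresponding_def by (force simp: lift_dual_def fst_combined)
qed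

text \<open>\<open>f\<close> can be read off from its lift on tuples of vertices in D. Injectivity
  lets the weights be carried over unchanged.\<close>

lemma lift_dual_inj:
  assumes "0 < k"
  shows "inj_on (lift_dual D cs k) (operations D k)"
proof (rule inj_onI)
  fix f g assume fg: "f \<in> operations D k" "g \<in> operations D k"
    and eq: "lift_dual D cs k f = lift_dual D cs k g"
  show "f = g"
  proof (rule PiE_ext[OF fg[unfolded operations_def]])
    fix ds assume ds: "ds \<in> tuples D k"
    then have "map Dom ds \<in> tuples (dual_verts D cs) k"
      by (rule tuples_map) (simp add: vertex_in_dual_verts)
    moreover have "ds \<noteq> []" using ds assms by (auto simp: tuples_def)
    ultimately show "f ds = g ds"
      using fun_cong[OF eq, of "map Dom ds"] by (simp add: lift_dual_def lift_op_Dom)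
  qed
qed

section \<open>Transport of the weights\<close>

lemma finite_dual_verts:
  assumes "finite D" shows "finite (dual_verts D cs)"
proof -
  have fin: "finite (dual_tuples D cs)"
    unfolding dual_tuples_def feas_def using finite_tuples[OF assms] by simp
  have "{Inner d x p | d x p. d \<in> D \<and> x \<in> dual_tuples D cs \<and> 0 < p \<and> p < length (edge_path d x)}
     = (\<Union>d\<in>D. \<Union>x\<in>dual_tuples D cs. Inner d x ` {0<..<length (edge_path d x)})"
    by (auto simp: image_iff)
  then show ?thesis using assms fin by (simp add: dual_verts_def)
qed

theorem theorem5p8:
  fixes D :: "'a set" and \<Gamma> :: "'a cost_fun set" and cs :: "'a cost_fun list"
    and k :: nat and \<omega> :: "('a list \<Rightarrow> 'a) \<Rightarrow> rat"
  assumes "finite D"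
    and "valued_language D \<Gamma>" and "finite \<Gamma>"
    and "distinct cs" and "set cs = \<Gamma>"
    and "\<forall>c\<in>\<Gamma>. feas D c \<noteq> {}"
    and "nonneg_cost D (combined D cs)"
    and "rigid_core D \<Gamma>"
    and "fractional_polymorphism D k \<Gamma> \<omega>"
  shows "\<exists>\<omega>e. fractional_polymorphism (dual_verts D cs) k (extended_dual D cs) \<omega>e \<and>
    (\<exists>h. bij_betw h (supp \<omega>) (supp \<omega>e) \<and>
         (\<forall>f \<in> supp \<omega>. corresponding D cs k f (h f) \<and> \<omega>e (h f) = \<omega> f))"
proof -
  let ?V = "dual_verts D cs" and ?P = "Pol D k \<Gamma>" and ?h = "lift_dual D cs k"
  let ?Q = "Pol ?V k (extended_dual D cs)" and ?m = "sum_list (map fst cs)"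
  \<comment> \<open>The push-forward of \<omega> along the injective lifting.\<close>
  define \<omega>e where "\<omega>e g = (if g \<in> ?h ` ?P then \<omega> (inv_into ?P ?h g) else 0)" for g
  have k: "0 < k" and nonneg: "\<And>f. 0 \<le> \<omega> f" and outside: "\<And>f. f \<notin> ?P \<Longrightarrow> \<omega> f = 0"
    and total: "(\<Sum>f\<in>?P. \<omega> f) = 1"
    using assms(9) by (auto simp: fractional_polymorphism_def)
  have inj: "inj_on ?h ?P"
    by (rule inj_on_subset[OF lift_dual_inj[OF k]]) (auto simp: Pol_def)
  have \<omega>e_lift: "\<omega>e (?h f) = \<omega> f" if "f \<in> ?P" for f
    using that inj by (simp add: \<omega>e_def)
  have sub: "?h ` ?P \<subseteq> ?Q" using lift_dual_Pol[OF _ k] assms(5) by blast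
  \<comment> \<open>Stated for arbitrary \<open>F\<close>, as it serves both the cost inequality
    and, with \<open>F\<close> constantly 1, the total weight.\<close>
  have reindex: "(\<Sum>g\<in>?Q. \<omega>e g * F g) = (\<Sum>f\<in>?P. \<omega> f * F (?h f))" for F
  proof -
    have "(\<Sum>g\<in>?Q. \<omega>e g * F g) = (\<Sum>g\<in>?h ` ?P. \<omega>e g * F g)"
      using sub finite_Pol[OF finite_dual_verts[OF assms(1)]]
      by (intro sum.mono_neutral_right) (auto simp: \<omega>e_def)
    then show ?thesis by (simp add: sum.reindex[OF inj] \<omega>e_lift)
  qed
  have digraph: "(\<Sum>g\<in>?Q. \<omega>e g * fin_part (snd (dual_digraph D cs) (app_cw 2 g xs)))
      \<le> (1 / of_nat k) * (\<Sum>x\<leftarrow>xs. fin_part (snd (dual_digraph D cs) x))"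
    if xs: "xs \<in> tuples (feas ?V (dual_digraph D cs)) k" for xs
  proof -
    \<comment> \<open>Feasible pairs cost 0 and polymorphisms keep them feasible, so both sides
      vanish.\<close>
    have zero: "fin_part (snd (dual_digraph D cs) x) = 0"
      if "x \<in> feas ?V (dual_digraph D cs)" for x
      using that by (auto simp: feas_def dual_digraph_def digraph_cost_def split: if_splits)
    have "app_cw 2 g xs \<in> feas ?V (dual_digraph D cs)" if "g \<in> ?Q" for g
      using that xs by (auto simp: Pol_def extended_dual_def fst_extended_dual)
    moreover have "(\<Sum>x\<leftarrow>xs. fin_part (snd (dual_digraph D cs) x)) = 0"
    proof -
      have *: "map (\<lambda>x. fin_part (snd (dual_digraph D cs) x)) xs = map (\<lambda>_. 0) xs"
        using xs zero by (auto simp: tuples_def)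
      show ?thesis unfolding * by simp
    qed
    ultimately show ?thesis using zero by (simp cong: sum.cong)
  qed
  have mu: "(\<Sum>g\<in>?Q. \<omega>e g * fin_part (snd (dual_mu D cs) (app_cw 1 g xs)))
      \<le> (1 / of_nat k) * (\<Sum>x\<leftarrow>xs. fin_part (snd (dual_mu D cs) x))"
    if xs: "xs \<in> tuples (feas ?V (dual_mu D cs)) k" for xs
  proof -
    define vs where "vs = map hd xs"
    have vs: "vs \<in> tuples ?V k"
      unfolding vs_def by (rule tuples_map[OF xs]) (auto simp: feas_dual_mu)
    have xs_eq: "xs = map (\<lambda>v. [v]) vs"
      unfolding vs_def map_map
      by (rule map_idI[symmetric]) (use xs in \<open>auto simp: tuples_def feas_dual_mu subset_iff\<close>)
    have lhs: "(\<Sum>g\<in>?Q. \<omega>e g * fin_part (snd (dual_mu D cs) (app_cw 1 g xs))) =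
        (\<Sum>f\<in>?P. \<omega> f * fin_part (snd (dual_mu D cs) [lift_op ?m f vs]))"
      unfolding reindex using vs by (simp add: xs_eq app_cw_def o_def lift_dual_def)
    have verts: "lift_op ?m f vs \<in> ?V" if "f \<in> ?P" for f
      using lift_op_verts[OF _ k vs] that assms(5) by blast
    show ?thesis
    proof (cases "set vs \<subseteq> Tup ` dual_tuples D cs")
      case True
      define ys where "ys = map tup_part vs"
      have ys: "ys \<in> tuples (dual_tuples D cs) k"
        using vs True by (auto simp: ys_def tuples_def)
      have vs_eq: "vs = map Tup ys"
        unfolding ys_def map_map by (rule map_idI[symmetric]) (use True in auto)
      have mu_Tup: "snd (dual_mu D cs) [Tup y] = combined_val cs y" if "y \<in> dual_tuples D cs" for y
        using that by (simp add: dual_mu_singleton vertex_in_dual_verts)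
      \<comment> \<open>On D' the lift acts as \<open>f\<close>, which leaves the inequality for the
        combined cost function.\<close>
      have "(\<Sum>f\<in>?P. \<omega> f * fin_part (snd (dual_mu D cs) [lift_op ?m f vs])) =
          (\<Sum>f\<in>?P. \<omega> f * fin_part (combined_val cs (app_cw ?m f ys)))"
        using verts by (intro sum.cong refl)
          (simp add: vs_eq lift_op_Tup[OF k ys] dual_mu_singleton)
      also have "\<dots> \<le> (1 / of_nat k) * (\<Sum>y\<leftarrow>ys. fin_part (combined_val cs y))"
        using fractional_combined[OF assms(9), of cs ys] ys assms(5) by (simp add: dual_tuples_def)
      also have "map (\<lambda>y. fin_part (combined_val cs y)) ys =
          map (\<lambda>x. fin_part (snd (dual_mu D cs) x)) xs"
        using ys mu_Tup by (auto simp: xs_eq vs_eq tuples_def)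
      finally show ?thesis unfolding lhs .
    next
      case False
      have "fin_part (snd (dual_mu D cs) [lift_op ?m f vs]) = 0" if "f \<in> ?P" for f
        using verts[OF that] lift_op_not_Tup[OF k vs False]
        by (auto simp: dual_mu_singleton zero_qbar_def split: vertex.split)
      \<comment> \<open>Some arguments may still lie in D' while the left side is 0; nonnegativity
        of the combined cost keeps their average from being negative.\<close>
      moreover have "0 \<le> fin_part (snd (dual_mu D cs) [v])" if "v \<in> ?V" for v
      proof (cases v)
        case (Tup y)
        then have y: "y \<in> feas D (combined D cs)"
          using that by (simp add: vertex_in_dual_verts dual_tuples_def)
        then have "snd (combined D cs) y = combined_val cs y"
          using feas_combined_tuples by (fastforce simp: combined_def Let_def)
        then show ?thesis
          using that Tup y assms(7) by (auto simp: dual_mu_singleton nonneg_cost_def)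
      qed (use that in \<open>auto simp: dual_mu_singleton zero_qbar_def\<close>)
      then have "0 \<le> (\<Sum>x\<leftarrow>xs. fin_part (snd (dual_mu D cs) x))"
        using vs by (intro sum_list_nonneg) (auto simp: xs_eq tuples_def)
      ultimately show ?thesis unfolding lhs by simp
    qed
  qed
  have "fractional_polymorphism ?V k (extended_dual D cs) \<omega>e"
    using k nonneg sub reindex[of "\<lambda>_. 1"] total digraph mu
    by (auto simp: fractional_polymorphism_def extended_dual_def fst_extended_dual \<omega>e_def)
  moreover have supp: "supp \<omega> \<subseteq> ?P" using outside by (force simp: supp_def)
  \<comment> \<open>Positive weights occur only on lifts, where they agree with those of
    \<omega>.\<close>
  have "bij_betw ?h (supp \<omega>) (supp \<omega>e)"
  proof -
    have "supp \<omega>e \<subseteq> ?h ` ?P" by (auto simp: supp_def \<omega>e_def split: if_splits)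
    then have "?h ` supp \<omega> = supp \<omega>e"
      using supp \<omega>e_lift by (fastforce simp: supp_def)
    then show ?thesis using inj_on_subset[OF inj supp] by (simp add: bij_betw_def)
  qed
  moreover have "corresponding D cs k f (?h f) \<and> \<omega>e (?h f) = \<omega> f" if "f \<in> supp \<omega>" for f
    using that supp lift_dual_corresponding[OF _ k] \<omega>e_lift assms(5) by blast
  ultimately show ?thesis by blast
qed

end
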